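(* Consider the piecewise constant case $\mathbf k=(0,0)$, so that $E_h,B_h$ belong to the space $W_h^{(0,0)}$ of functions that are constant on each of the $N=N_xN_y$ cells of a uniform rectangular mesh. Let $\Delta t>0$, $\alpha_0,\beta_0>0$, and let $a_{ii}\ge 0$ be a diagonal entry of the implicit Runge–Kutta matrix. For a coefficient vector $U=(\boldsymbol{E_c},\boldsymbol{B_c})\in\mathbb R^{2N}$ let $$A(U)=\begin{pmatrix} \frac{1}{\Delta t}M_h-a_{ii}\alpha_0S_h+a_{ii}\Lambda_{h,T} & -a_{ii}\Lambda_{h,T}\\[4pt] -a_{ii}Z_h & \frac{1}{\Delta t}M_h+a_{ii}Z_h-a_{ii}\beta_0S_h\end{pmatrix}\in\mathbb R^{2N\times 2N},$$ where $M_h$, $S_h$, $Z_h$, $\Lambda_{h,T}$ are the mass, LDG diffusion, $z^3$-weighted mass and $\sigma$-weighted mass matrices defined in the context, and $T$ is determined by $U$ through $T=B^{1/4}$. If $U\ge 0$ entrywise (with $\boldsymbol{B_c}>0$ entrywise, so that $\Lambda_{h,T}$ is defined), then $A(U)$ is an $\mathbf M$-matrix.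
   Context: **M-matrix.** A real square matrix is an $\mathbf M$-matrix if its off-diagonal entries are all nonpositive and it is invertible with entrywise nonnegative inverse. **Mesh.** $\Omega\subset\mathbb R^2$ is a rectangle partitioned uniformly into cells $I_{i,j}=[x_{i-1/2},x_{i+1/2}]\times[y_{j-1/2},y_{j+1/2}]$, $1\le i\le N_x$, $1\le j\le N_y$, with edge lengths $h_x,h_y>0$ and centers $(x_i,y_j)$; $\mathcal T_h$ is the set of cells. $W_h^{(0,0)}$ is the space of functions on $\Omega$ that are constant on each cell, with basis the indicator functions of the cells, ordered with $i$ running fastest, then $j$. $\mathbf W_h^{(0,0)}=W_h^{(0,0)}\times W_h^{(0,0)}$. The coefficient vector of $u_h\in W_h^{(0,0)}$ is denoted $\boldsymbol{u_c}\in\mathbb R^N$, $N=N_xN_y$. $(\cdot,\cdot)$ is the $L^2(\Omega)$ inner product. **Coefficients.** $z:\Omega\to(0,\infty)$ is a given bounded measurable function (defined at the cell centers), and $\sigma=z^3/T^3$, where for $U=(\boldsymbol{E_c},\boldsymbol{B_c})$ the function $T_h\in W_h^{(0,0)}$ is given cellwise by $T_h=B_h^{1/4}$. **Matrices** (entries obtained by testing with each basis function $\mu\in W_h^{(0,0)}$): - $M_h$: the vector $M_h\boldsymbol{u_c}$ represents $\mu\mapsto(u_h,\mu)$. - $Z_h$: the vector $Z_h\boldsymbol{u_c}$ represents $\mu\mapsto(z^3u_h,\mu)$. - $\Lambda_{h,T}$: the vector $\Lambda_{h,T}\boldsymbol{u_c}$ represents $\mu\mapsto(\sigma_hu_h,\mu)$,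 evaluated on each cell by the tensor-product Gauss quadrature with $k_\ell+1$ points in direction $\ell$; for $\mathbf k=(0,0)$ this is the one-point rule at the cell center: $\int_{I_{i,j}}\sigma u_h\mu\,d\mathbf x\approx h_xh_y(\sigma u_h\mu)(x_i,y_j)$. - $S_h$: the LDG discretization of the Laplacian. Given $u_h\in W_h^{(0,0)}$, let $\mathbf p_h\in\mathbf W_h^{(0,0)}$ be defined by $$(\mathbf p_h,\boldsymbol\upsilon)=-\sum_{K\in\mathcal T_h}\int_Ku_h\nabla\cdot\boldsymbol\upsilon\,d\mathbf x+\sum_{K\in\mathcal T_h}\int_{\partial K}\mathbf n\cdot\boldsymbol\upsilon\,\hat u_h\,ds\quad\text{for all }\boldsymbol\upsilon\in\mathbf W_h^{(0,0)}.$$ Then $S_h\boldsymbol{u_c}$ represents $$\mu\mapsto-\sum_{K\in\mathcal T_h}\int_K\mathbf p_h\cdot\nabla\mu\,d\mathbf x+\sum_{K\in\mathcal T_h}\int_{\partial K}\mathbf n\cdot\hat{\mathbf p}_h\,\mu\,ds .$$ Here $\mathbf n$ is the outward unit normal of $K$ on $\partial K$, and in each cell integral over $\partial K$ the test function is the trace from inside $K$. The numerical fluxes on interior edges are alternating: $\hat u_h=u_h^-$ is the value from the left cell (vertical edges) or the lower cell (horizontal edges), and $\hat{\mathbf p}_h=\mathbf p_h^+$ is the value from the right cell or the upper cell. On the boundary of $\Omega$, either periodic conditions are imposed (cells are identified periodically and the same fluxes are used), or homogeneous Neumann conditions are imposed: $\hat u_h$ is the value from inside $\Omega$ and $\mathbf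 n\cdot\hat{\mathbf p}_h=0$. **Origin of $A$.** $A(\tilde U^{(i)})\tilde U^{(i)}=F$ is the nonlinear algebraic system of the predictor step at stage $i$ of the implicit-explicit Runge–Kutta LDG scheme for the radiation diffusion system; $a_{ii}$ is the $i$-th diagonal entry of the implicit tableau. *)

theory Defs
  imports "HOL-Analysis.Analysis" "Jordan_Normal_Form.Matrix"
begin

unbundle no vec_syntax

definition M_matrix :: "real mat \<Rightarrow> bool" where
  "M_matrix A \<longleftrightarrow> square_mat A \<and>
     (\<forall>k<dim_row A. \<forall>l<dim_row A. k \<noteq> l \<longrightarrow> A $$ (k, l) \<le> 0) \<and>
     (\<exists>B \<in> carrier_mat (dim_row A) (dim_row A). inverts_mat A B \<and> inverts_mat B A \<and>
        (\<forall>k<dim_row A. \<forall>l<dim_row A. 0 \<le> B $$ (k, l)))"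


section \<open>Uniform rectangular meshes\<close>

text \<open>
  The pair \<open>(x0, y0)\<close> is the lower left corner of the rectangle. Cells are indexed from 0, so that
  \<open>x_edge m i\<close> and \<open>x_edge m (Suc i)\<close> are the abscissae of the left and right edges of
  the cells in column \<open>i\<close>.
\<close>

record mesh =
  x0 :: real
  y0 :: real
  hx :: real
  hy :: real
  Nx :: nat
  Ny :: nat

definition valid_mesh :: "mesh \<Rightarrow> bool" where
  "valid_mesh m \<longleftrightarrow> 0 < hx m \<and> 0 < hy m \<and> 0 < Nx m \<and> 0 < Ny m"

definition x_edge :: "mesh \<Rightarrow> nat \<Rightarrow> real" where
  "x_edge m i = x0 m + real i * hx m"

definition y_edge :: "mesh \<Rightarrow> nat \<Rightarrow> real" where
  "y_edge m j = y0 m + real j * hy m"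

definition Omega :: "mesh \<Rightarrow> (real \<times> real) set" where
  "Omega m = {x_edge m 0 .. x_edge m (Nx m)} \<times> {y_edge m 0 .. y_edge m (Ny m)}"

definition cells :: "mesh \<Rightarrow> (nat \<times> nat) set" where
  "cells m = {..<Nx m} \<times> {..<Ny m}"

definition cell :: "mesh \<Rightarrow> nat \<times> nat \<Rightarrow> (real \<times> real) set" where
  "cell m K = {x_edge m (fst K) .. x_edge m (Suc (fst K))} \<times>
              {y_edge m (snd K) .. y_edge m (Suc (snd K))}"

definition center :: "mesh \<Rightarrow> nat \<times> nat \<Rightarrow> real \<times> real" where
  "center m K = ((x_edge m (fst K) + x_edge m (Suc (fst K))) / 2,
                 (y_edge m (snd K) + y_edge m (Suc (snd K))) / 2)"

definition ncells :: "mesh \<Rightarrow> nat" where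
  "ncells m = Nx m * Ny m"

definition cell_index :: "mesh \<Rightarrow> nat \<Rightarrow> nat \<times> nat" where
  "cell_index m k = (k mod Nx m, k div Nx m)"


section \<open>Piecewise constant functions\<close>

text \<open>
  Elements of the discontinuous space have no distinguished value on the edges of the mesh, where
  only the traces from the adjacent cells matter. The representative that vanishes on the edges (and
  outside the rectangle) is chosen, which makes a function in \<open>Wh m\<close> determined by its cell values.
\<close>

definition Wh :: "mesh \<Rightarrow> (real \<times> real \<Rightarrow> real) set" where
  "Wh m = {u. (\<forall>K\<in>cells m. u constant_on interior (cell m K)) \<and>
              (\<forall>p. p \<notin> (\<Union>K\<in>cells m. interior (cell m K)) \<longrightarrow> u p = 0)}"

definition Wh_vec :: "mesh \<Rightarrow> (real \<times> real \<Rightarrow> real \<times> real) set" where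
  "Wh_vec m = {p. fst \<circ> p \<in> Wh m \<and> snd \<circ> p \<in> Wh m}"

definition basis_fun :: "mesh \<Rightarrow> nat \<Rightarrow> real \<times> real \<Rightarrow> real" where
  "basis_fun m k = indicator (interior (cell m (cell_index m k)))"

definition fun_of_coeffs :: "mesh \<Rightarrow> real vec \<Rightarrow> real \<times> real \<Rightarrow> real" where
  "fun_of_coeffs m c = (\<lambda>p. \<Sum>k<ncells m. c $ k * basis_fun m k p)"

definition L2_inner ::
  "mesh \<Rightarrow> (real \<times> real \<Rightarrow> 'a::euclidean_space) \<Rightarrow> (real \<times> real \<Rightarrow> 'a) \<Rightarrow> real" where
  "L2_inner m u v = (LINT p:Omega m|lebesgue. inner (u p) (v p))"

text \<open>
  The matrix of a form \<open>a\<close> whose first argument is the trial function and whose second argument is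
  the test function: row \<open>k\<close> corresponds to testing with the \<open>k\<close>-th basis function.
\<close>

definition form_mat ::
  "mesh \<Rightarrow> ((real \<times> real \<Rightarrow> real) \<Rightarrow> (real \<times> real \<Rightarrow> real) \<Rightarrow> real) \<Rightarrow> real mat" where
  "form_mat m a =
     mat (ncells m) (ncells m) (\<lambda>(k, l). a (basis_fun m l) (basis_fun m k))"


section \<open>Mass matrices\<close>

definition mass_mat :: "mesh \<Rightarrow> real mat" where
  "mass_mat m = form_mat m (L2_inner m)"

definition z_mat :: "mesh \<Rightarrow> (real \<times> real \<Rightarrow> real) \<Rightarrow> real mat" where
  "z_mat m z = form_mat m (\<lambda>u \<mu>. L2_inner m (\<lambda>p. z p ^ 3 * u p) \<mu>)"

definition temperature :: "mesh \<Rightarrow> real vec \<Rightarrow> real \<times> real \<Rightarrow> real" where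
  "temperature m B = (\<lambda>p. fun_of_coeffs m B p powr (1 / 4))"

definition sigma :: "mesh \<Rightarrow> (real \<times> real \<Rightarrow> real) \<Rightarrow> real vec \<Rightarrow> real \<times> real \<Rightarrow> real" where
  "sigma m z B = (\<lambda>p. z p ^ 3 / temperature m B p ^ 3)"

definition sigma_mat :: "mesh \<Rightarrow> (real \<times> real \<Rightarrow> real) \<Rightarrow> real vec \<Rightarrow> real mat" where
  "sigma_mat m z B = form_mat m
     (\<lambda>u \<mu>. \<Sum>K\<in>cells m. hx m * hy m *
        (sigma m z B (center m K) * u (center m K) * \<mu> (center m K)))"


section \<open>LDG discretization of the Laplacian\<close>

datatype boundary_cond = Periodic | Neumann

datatype side = West | East | South | North

fun opposite :: "side \<Rightarrow> side" where
  "opposite West = East"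
| "opposite East = West"
| "opposite South = North"
| "opposite North = South"

fun normal_vec :: "side \<Rightarrow> real \<times> real" where
  "normal_vec West = (-1, 0)"
| "normal_vec East = (1, 0)"
| "normal_vec South = (0, -1)"
| "normal_vec North = (0, 1)"

text \<open>
  The cell on the other side of an edge; \<open>None\<close> if the edge lies on a (Neumann) boundary. With
  periodic conditions the two opposite boundary edges are identified.
\<close>

fun neighbour :: "boundary_cond \<Rightarrow> mesh \<Rightarrow> nat \<times> nat \<Rightarrow> side \<Rightarrow> (nat \<times> nat) option" where
  "neighbour Periodic m (i, j) West = Some ((i + Nx m - 1) mod Nx m, j)"
| "neighbour Periodic m (i, j) East = Some ((i + 1) mod Nx m, j)"
| "neighbour Periodic m (i, j) South = Some (i, (j + Ny m - 1) mod Ny m)"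
| "neighbour Periodic m (i, j) North = Some (i, (j + 1) mod Ny m)"
| "neighbour Neumann m (i, j) West = (if i = 0 then None else Some (i - 1, j))"
| "neighbour Neumann m (i, j) East = (if i + 1 < Nx m then Some (i + 1, j) else None)"
| "neighbour Neumann m (i, j) South = (if j = 0 then None else Some (i, j - 1))"
| "neighbour Neumann m (i, j) North = (if j + 1 < Ny m then Some (i, j + 1) else None)"

text \<open>
  Each side of a cell is parametrized by the coordinate \<open>t\<close> that varies along it. The same \<open>t\<close>
  describes the same point of an edge seen from the two adjacent cells, and corresponding points of
  periodically identified edges.
\<close>

fun side_point :: "mesh \<Rightarrow> nat \<times> nat \<Rightarrow> side \<Rightarrow> real \<Rightarrow> real \<times> real" where
  "side_point m (i, j) West t = (x_edge m i, t)"
| "side_point m (i, j) East t = (x_edge m (Suc i), t)"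
| "side_point m (i, j) South t = (t, y_edge m j)"
| "side_point m (i, j) North t = (t, y_edge m (Suc j))"

fun side_range :: "mesh \<Rightarrow> nat \<times> nat \<Rightarrow> side \<Rightarrow> real set" where
  "side_range m (i, j) West = {y_edge m j .. y_edge m (Suc j)}"
| "side_range m (i, j) East = {y_edge m j .. y_edge m (Suc j)}"
| "side_range m (i, j) South = {x_edge m i .. x_edge m (Suc i)}"
| "side_range m (i, j) North = {x_edge m i .. x_edge m (Suc i)}"

definition boundary_integral :: "mesh \<Rightarrow> nat \<times> nat \<Rightarrow> (side \<Rightarrow> real \<Rightarrow> real) \<Rightarrow> real" where
  "boundary_integral m K g =
     (\<Sum>s\<in>{West, East, South, North}. LINT t:side_range m K s|lebesgue. g s t)"

definition trace_in ::
  "mesh \<Rightarrow> (real \<times> real \<Rightarrow> 'a::t2_space) \<Rightarrow> nat \<times> nat \<Rightarrow> side \<Rightarrow> real \<Rightarrow> 'a" where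
  "trace_in m u K s t = Lim (at (side_point m K s t) within interior (cell m K)) u"

text \<open>
  Alternating fluxes: \<open>u_flux\<close> takes the value from the left or lower cell, which is the
  cell \<open>K\<close> itself on its east and north sides, and \<open>p_flux\<close> the value from the right or upper cell.
  On a Neumann boundary \<open>u_flux\<close> takes the value from inside. The normal component of \<open>p_flux\<close>
  vanishes there, whence the value 0.
\<close>

definition u_flux ::
  "boundary_cond \<Rightarrow> mesh \<Rightarrow> (real \<times> real \<Rightarrow> real) \<Rightarrow> nat \<times> nat \<Rightarrow> side \<Rightarrow> real \<Rightarrow> real" where
  "u_flux bc m u K s t =
     (case neighbour bc m K s of
        None \<Rightarrow> trace_in m u K s t
      | Some L \<Rightarrow> if s \<in> {East, North} then trace_in m u K s t
                 else trace_in m u L (opposite s) t)"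

definition normal_p_flux ::
  "boundary_cond \<Rightarrow> mesh \<Rightarrow> (real \<times> real \<Rightarrow> real \<times> real) \<Rightarrow> nat \<times> nat \<Rightarrow> side \<Rightarrow> real \<Rightarrow> real" where
  "normal_p_flux bc m p K s t =
     (case neighbour bc m K s of
        None \<Rightarrow> 0
      | Some L \<Rightarrow> inner (normal_vec s)
                  (if s \<in> {East, North} then trace_in m p L (opposite s) t
                   else trace_in m p K s t))"

definition gradient :: "(real \<times> real \<Rightarrow> real) \<Rightarrow> real \<times> real \<Rightarrow> real \<times> real" where
  "gradient \<mu> q = (deriv (\<lambda>x. \<mu> (x, snd q)) (fst q), deriv (\<lambda>y. \<mu> (fst q, y)) (snd q))"

definition divergence :: "(real \<times> real \<Rightarrow> real \<times> real) \<Rightarrow> real \<times> real \<Rightarrow> real" where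
  "divergence v q =
     deriv (\<lambda>x. fst (v (x, snd q))) (fst q) + deriv (\<lambda>y. snd (v (fst q, y))) (snd q)"

text \<open>
  The piecewise constant flux \<open>p\<close> is determined by its \<open>L2_inner\<close> products with all of \<open>Wh_vec m\<close>.
\<close>

definition ldg_grad ::
  "boundary_cond \<Rightarrow> mesh \<Rightarrow> (real \<times> real \<Rightarrow> real) \<Rightarrow> real \<times> real \<Rightarrow> real \<times> real" where
  "ldg_grad bc m u = (THE p. p \<in> Wh_vec m \<and>
     (\<forall>v\<in>Wh_vec m. L2_inner m p v =
        - (\<Sum>K\<in>cells m. LINT q:cell m K|lebesgue. u q * divergence v q)
        + (\<Sum>K\<in>cells m. boundary_integral m K
             (\<lambda>s t. inner (normal_vec s) (trace_in m v K s t) * u_flux bc m u K s t))))"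

definition ldg_laplacian ::
  "boundary_cond \<Rightarrow> mesh \<Rightarrow> (real \<times> real \<Rightarrow> real) \<Rightarrow> (real \<times> real \<Rightarrow> real) \<Rightarrow> real" where
  "ldg_laplacian bc m u \<mu> =
     - (\<Sum>K\<in>cells m. LINT q:cell m K|lebesgue. inner (ldg_grad bc m u q) (gradient \<mu> q))
     + (\<Sum>K\<in>cells m. boundary_integral m K
          (\<lambda>s t. normal_p_flux bc m (ldg_grad bc m u) K s t * trace_in m \<mu> K s t))"

definition ldg_mat :: "boundary_cond \<Rightarrow> mesh \<Rightarrow> real mat" where
  "ldg_mat bc m = form_mat m (ldg_laplacian bc m)"


section \<open>The predictor matrix\<close>

definition system_mat ::
  "boundary_cond \<Rightarrow> mesh \<Rightarrow> (real \<times> real \<Rightarrow> real) \<Rightarrow> real \<Rightarrow> real \<Rightarrow> real \<Rightarrow> real \<Rightarrow> real vec \<Rightarrow> real mat" where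
  "system_mat bc m z dt \<alpha> \<beta> a U =
     (let B = vec_last U (ncells m);
          M = mass_mat m; S = ldg_mat bc m; Z = z_mat m z; \<Lambda> = sigma_mat m z B
      in four_block_mat
           ((1 / dt) \<cdot>\<^sub>m M - (a * \<alpha>) \<cdot>\<^sub>m S + a \<cdot>\<^sub>m \<Lambda>)  (- (a \<cdot>\<^sub>m \<Lambda>))
           (- (a \<cdot>\<^sub>m Z))  ((1 / dt) \<cdot>\<^sub>m M + a \<cdot>\<^sub>m Z - (a * \<beta>) \<cdot>\<^sub>m S))"

end

theory Submission
  imports Defs "Jordan_Normal_Form.Determinant"
begin

text \<open>
  The argument is strict row dominance. A matrix with nonpositive off-diagonal entries and positive
  row sums is an M-matrix (\<open>M_matrixI\<close>), by a discrete minimum principle: at an index where \<open>x\<close>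
  attains a negative minimum, \<open>A x\<close> would be negative. So \<open>A x \<ge> 0\<close> forces \<open>x \<ge> 0\<close>, which gives
  both injectivity and the sign of the inverse.

  The row sums of the predictor matrix are explicit. The reaction term, \<open>\<Lambda>\<close> in the first block row and
  \<open>Z\<close> in the second, enters its row once with each sign and cancels. The diffusion terms
  annihilate constants. What is left is the mass term \<open>hx hy / dt\<close>, the same in every row
  (\<open>system_mat_row_sum\<close>). The off-diagonal signs follow because \<open>M\<close>, \<open>Z\<close> and \<open>\<Lambda>\<close> are diagonal, the last two with nonnegative entries, and because \<open>S\<close>
  has nonnegative off-diagonal entries.

  The substance is therefore the claim about \<open>S\<close>. For piecewise constants all volume integrals in
  the LDG scheme vanish, the auxiliary variable is the vector of backward differences of the cell
  values (\<open>ldg_grad_pw_const\<close>), and the opposite choice of flux in the second equation takes forward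
  differences of those. The composition is the five-point Laplacian (\<open>ldg_laplacian_pw_const\<close>): each
  cell is compared with its four neighbours with positive weights. Homogeneous Neumann conditions
  amount to letting a boundary cell be its own neighbour.
\<close>

section \<open>A criterion for M-matrices\<close>

text \<open>
  Let \<open>k\<close> be an index at which \<open>x\<close> is minimal. Since the off-diagonal entries of row \<open>k\<close> are
  nonpositive, replacing every \<open>x $ l\<close> by \<open>x $ k\<close> can only increase row \<open>k\<close> of \<open>A x\<close>, and the result is
  the row sum times \<open>x $ k\<close>. This excludes \<open>x $ k < 0\<close>.
\<close>

lemma nonneg_of_mult_mat_vec_nonneg:
  fixes A :: "real mat"
  assumes A: "A \<in> carrier_mat n n"
    and off: "\<And>k l. k < n \<Longrightarrow> l < n \<Longrightarrow> k \<noteq> l \<Longrightarrow> A $$ (k, l) \<le> 0"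
    and rows: "\<And>k. k < n \<Longrightarrow> 0 < (\<Sum>l<n. A $$ (k, l))"
    and x: "x \<in> carrier_vec n"
    and Ax: "\<And>k. k < n \<Longrightarrow> 0 \<le> (A *\<^sub>v x) $ k"
    and i: "i < n"
  shows "0 \<le> x $ i"
proof -
  obtain k where k: "k < n" and least: "\<And>l. l < n \<Longrightarrow> x $ k \<le> x $ l"
  proof -
    have "finite ((\<lambda>l. x $ l) ` {..<n})" "(\<lambda>l. x $ l) ` {..<n} \<noteq> {}" using i by auto
    from Min_in[OF this] Min_le[OF this(1)] show ?thesis using that by fastforce
  qed
  have "0 \<le> x $ k"
  proof (rule ccontr)
    assume neg: "\<not> 0 \<le> x $ k"
    have "(A *\<^sub>v x) $ k = (\<Sum>l<n. A $$ (k, l) * x $ l)"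
      using A x k by (auto simp: scalar_prod_def lessThan_atLeast0 intro!: sum.cong)
    also have "\<dots> \<le> (\<Sum>l<n. A $$ (k, l) * x $ k)"
    proof (rule sum_mono)
      fix l assume l: "l \<in> {..<n}"
      show "A $$ (k, l) * x $ l \<le> A $$ (k, l) * x $ k"
        using off[of k l] least[of l] l k by (cases "l = k") (auto intro: mult_left_mono_neg)
    qed
    also have "\<dots> = (\<Sum>l<n. A $$ (k, l)) * x $ k" by (simp add: sum_distrib_right)
    also have "\<dots> < 0" using rows[OF k] neg by (simp add: mult_less_0_iff)
    finally show False using Ax[OF k] by simp
  qed
  with least[OF i] show ?thesis by simp
qed

text \<open>
  Applied to \<open>v\<close> and \<open>- v\<close>, the minimum principle shows that the kernel of \<open>A\<close> is trivial. Applied to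
  the columns of the inverse, which \<open>A\<close> maps to unit vectors, it shows that the inverse is nonnegative.
\<close>

lemma M_matrixI:
  fixes A :: "real mat"
  assumes A: "A \<in> carrier_mat n n"
    and off: "\<And>k l. k < n \<Longrightarrow> l < n \<Longrightarrow> k \<noteq> l \<Longrightarrow> A $$ (k, l) \<le> 0"
    and rows: "\<And>k. k < n \<Longrightarrow> 0 < (\<Sum>l<n. A $$ (k, l))"
  shows "M_matrix A"
proof -
  note monotone = nonneg_of_mult_mat_vec_nonneg[OF A off rows]
  have "det A \<noteq> 0"
  proof
    assume "det A = 0"
    then obtain v where v: "v \<in> carrier_vec n" "v \<noteq> 0\<^sub>v n" "A *\<^sub>v v = 0\<^sub>v n"
      using det_0_iff_vec_prod_zero[OF A] by blast
    have "A *\<^sub>v ((-1) \<cdot>\<^sub>v v) = 0\<^sub>v n"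
      using A v by (auto simp: mult_mat_vec)
    then have "v $ i = 0" if "i < n" for i
      using monotone[of v i] monotone[of "(-1) \<cdot>\<^sub>v v" i] v that by simp
    then have "v = 0\<^sub>v n" using v(1) by auto
    with v(2) show False by simp
  qed
  from det_non_zero_imp_unit[OF A this]
  obtain B where B: "B \<in> carrier_mat n n" and BA: "B * A = 1\<^sub>m n" and AB: "A * B = 1\<^sub>m n"
    unfolding Units_def ring_mat_def by auto
  have "0 \<le> B $$ (k, l)" if k: "k < n" and l: "l < n" for k l
  proof -
    have "A *\<^sub>v col B l = col (A * B) l" using A B l by (simp add: col_mult2)
    then have "(A *\<^sub>v col B l) $ i = (if i = l then 1 else 0)" if "i < n" for i
      using that l by (simp add: AB)
    then have "0 \<le> col B l $ k" using monotone[of "col B l" k] B k by (auto simp: carrier_vecI)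
    then show ?thesis using B k l by simp
  qed
  then show ?thesis
    unfolding M_matrix_def inverts_mat_def using A B AB BA off by auto
qed

section \<open>Cell geometry\<close>

lemma x_edge_Suc: "x_edge m (Suc i) = x_edge m i + hx m"
  by (simp add: x_edge_def algebra_simps)

lemma y_edge_Suc: "y_edge m (Suc j) = y_edge m j + hy m"
  by (simp add: y_edge_def algebra_simps)

lemma interior_cell:
  "interior (cell m K) = {x_edge m (fst K) <..< x_edge m (Suc (fst K))} \<times>
                         {y_edge m (snd K) <..< y_edge m (Suc (snd K))}"
  by (simp add: cell_def interior_Times)

lemma closure_interior_cell:
  assumes "valid_mesh m"
  shows "closure (interior (cell m K)) = cell m K"
  unfolding interior_cell
  using assms by (simp add: cell_def closure_Times x_edge_Suc y_edge_Suc valid_mesh_def)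

lemma center_in_interior:
  assumes "valid_mesh m"
  shows "center m K \<in> interior (cell m K)"
  using assms by (simp add: interior_cell center_def x_edge_Suc y_edge_Suc valid_mesh_def)

lemma grid_index_unique:
  fixes h x :: real
  assumes "0 < h" "c + real i * h < x" "x < c + real i * h + h"
    "c + real i' * h < x" "x < c + real i' * h + h"
  shows "i = i'"
proof -
  have "\<not> i < i'" if "c + real i' * h < x" "x < c + real i * h + h" for i i'
  proof
    assume "i < i'"
    then have "real i + 1 \<le> real i'" by simp
    then have "(real i + 1) * h \<le> real i' * h" using assms(1) by (intro mult_right_mono) auto
    with that show False by (simp add: algebra_simps)
  qed
  from this[of i' i] this[of i i'] assms show ?thesis by force
qed

lemma interior_cells_disjoint:
  assumes "valid_mesh m" "p \<in> interior (cell m K)" "p \<in> interior (cell m L)"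
  shows "K = L"
  using assms grid_index_unique[of "hx m" "x0 m" "fst K" "fst p" "fst L"]
    grid_index_unique[of "hy m" "y0 m" "snd K" "snd p" "snd L"]
  unfolding interior_cell valid_mesh_def x_edge_Suc y_edge_Suc
  by (auto simp: x_edge_def y_edge_def prod_eq_iff)

lemma cell_subset_Omega:
  assumes "valid_mesh m" "K \<in> cells m"
  shows "cell m K \<subseteq> Omega m"
proof -
  have "real (Suc (fst K)) * hx m \<le> real (Nx m) * hx m"
    "real (Suc (snd K)) * hy m \<le> real (Ny m) * hy m"
    "0 \<le> real (fst K) * hx m" "0 \<le> real (snd K) * hy m"
    using assms by (auto simp: cells_def valid_mesh_def simp del: of_nat_Suc intro!: mult_right_mono)
  then show ?thesis by (auto simp: cell_def Omega_def x_edge_def y_edge_def)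
qed

lemma measure_interior_cell:
  assumes "valid_mesh m"
  shows "measure lebesgue (interior (cell m K)) = hx m * hy m"
proof -
  have c: "cell m K = cbox (x_edge m (fst K), y_edge m (snd K)) (x_edge m (Suc (fst K)), y_edge m (Suc (snd K)))"
    by (simp add: cell_def cbox_Pair_eq)
  have "measure lebesgue (interior (cell m K)) = measure lebesgue (cell m K)"
    unfolding c by (intro measure_interior) (auto simp: negligible_frontier_interval bounded_cbox negligible_convex_frontier)
  also have "\<dots> = hx m * hy m"
    using assms unfolding c by (simp add: content_Pair x_edge_Suc y_edge_Suc valid_mesh_def)
  finally show ?thesis .
qed

lemma interior_cell_lmeasurable: "interior (cell m K) \<in> lmeasurable"
  by (intro lmeasurable_open open_interior bounded_interior)
     (simp add: cell_def bounded_Times)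

section \<open>Piecewise constant functions\<close>

text \<open>
  One notion for scalar and vector valued functions, normalized as in \<open>Wh\<close>: the value on a cell is
  read off at the center, and the function vanishes off the open cells.
\<close>

definition pw_const :: "mesh \<Rightarrow> (real \<times> real \<Rightarrow> 'a::zero) \<Rightarrow> bool" where
  "pw_const m u \<longleftrightarrow> (\<forall>K\<in>cells m. \<forall>q\<in>interior (cell m K). u q = u (center m K)) \<and>
     (\<forall>q. q \<notin> (\<Union>K\<in>cells m. interior (cell m K)) \<longrightarrow> u q = 0)"

lemma Wh_iff_pw_const:
  assumes "valid_mesh m"
  shows "u \<in> Wh m \<longleftrightarrow> pw_const m u"
proof -
  have "u constant_on interior (cell m K) \<longleftrightarrow> (\<forall>q\<in>interior (cell m K). u q = u (center m K))" for K
    unfolding constant_on_def using center_in_interior[OF assms, of K] by metis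
  then show ?thesis by (simp only: Wh_def pw_const_def mem_Collect_eq)
qed

lemma Wh_vec_iff_pw_const:
  assumes "valid_mesh m"
  shows "v \<in> Wh_vec m \<longleftrightarrow> pw_const m v"
  unfolding Wh_vec_def mem_Collect_eq Wh_iff_pw_const[OF assms] pw_const_def comp_def
    prod_eq_iff[of "v _"] fst_zero snd_zero by blast

lemma pw_constD: "pw_const m u \<Longrightarrow> K \<in> cells m \<Longrightarrow> q \<in> interior (cell m K) \<Longrightarrow> u q = u (center m K)"
  by (simp add: pw_const_def)

lemma pw_const_nonzeroE:
  assumes "pw_const m u" "u q \<noteq> 0"
  obtains K where "K \<in> cells m" "q \<in> interior (cell m K)"
  using assms unfolding pw_const_def by blast

lemma pw_const_eqI:
  assumes "pw_const m u" "pw_const m v" "\<And>K. K \<in> cells m \<Longrightarrow> u (center m K) = v (center m K)"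
  shows "u = v"
proof
  fix q show "u q = v q"
  proof (cases "q \<in> (\<Union>K\<in>cells m. interior (cell m K))")
    case True
    then obtain K where "K \<in> cells m" "q \<in> interior (cell m K)" by blast
    then show ?thesis using pw_constD[OF assms(1)] pw_constD[OF assms(2)] assms(3) by metis
  next
    case False
    then show ?thesis using assms(1,2) unfolding pw_const_def by metis
  qed
qed

definition step_fun :: "mesh \<Rightarrow> (nat \<times> nat \<Rightarrow> 'a::real_vector) \<Rightarrow> real \<times> real \<Rightarrow> 'a" where
  "step_fun m f q = (\<Sum>K\<in>cells m. indicator (interior (cell m K)) q *\<^sub>R f K)"

lemma finite_cells [simp]: "finite (cells m)"
  by (simp add: cells_def)

lemma step_fun_interior:
  assumes "valid_mesh m" "K \<in> cells m" "q \<in> interior (cell m K)"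
  shows "step_fun m f q = f K"
proof -
  have "step_fun m f q = (\<Sum>L\<in>cells m. if L = K then f K else 0)"
    unfolding step_fun_def
  proof (rule sum.cong)
    fix L
    show "indicator (interior (cell m L)) q *\<^sub>R f L = (if L = K then f K else 0)"
    proof (cases "L = K")
      case False
      then have "q \<notin> interior (cell m L)" using interior_cells_disjoint[OF assms(1,3)] by blast
      then show ?thesis using False by simp
    qed (use assms(3) in simp)
  qed simp
  then show ?thesis using assms by simp
qed

lemma step_fun_center:
  assumes "valid_mesh m" "K \<in> cells m"
  shows "step_fun m f (center m K) = f K"
  using step_fun_interior[OF assms center_in_interior[OF assms(1)]] .

lemma pw_const_step_fun:
  assumes "valid_mesh m"
  shows "pw_const m (step_fun m f)"
  unfolding pw_const_def
proof (intro conjI ballI allI impI)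
  fix K q assume "K \<in> cells m" "q \<in> interior (cell m K)"
  then show "step_fun m f q = step_fun m f (center m K)"
    using assms by (simp add: step_fun_interior step_fun_center)
next
  fix q assume "q \<notin> (\<Union>K\<in>cells m. interior (cell m K))"
  then show "step_fun m f q = 0" by (auto simp: step_fun_def indicator_def intro!: sum.neutral)
qed

text \<open>
  The pointwise product is again a step function, and all open cells have the same measure.
\<close>

lemma L2_inner_pw_const:
  fixes u v :: "real \<times> real \<Rightarrow> 'a::euclidean_space"
  assumes m: "valid_mesh m" and u: "pw_const m u" and v: "pw_const m v"
  shows "L2_inner m u v = hx m * hy m * (\<Sum>K\<in>cells m. inner (u (center m K)) (v (center m K)))"
proof -
  let ?c = "\<lambda>K. inner (u (center m K)) (v (center m K))"
  have uv: "pw_const m (\<lambda>q. inner (u q) (v q))"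
    using u v unfolding pw_const_def by (metis inner_zero_left)
  then have eq: "(\<lambda>q. inner (u q) (v q)) = step_fun m ?c"
    by (rule pw_const_eqI[OF _ pw_const_step_fun[OF m]]) (simp add: step_fun_center m)
  have "indicat_real (Omega m) q *\<^sub>R inner (u q) (v q)
      = (\<Sum>K\<in>cells m. indicat_real (interior (cell m K)) q *\<^sub>R ?c K)" for q
  proof -
    have "q \<in> Omega m" if "inner (u q) (v q) \<noteq> 0"
      using pw_const_nonzeroE[OF uv that] cell_subset_Omega[OF m] interior_subset by blast
    then have "indicat_real (Omega m) q *\<^sub>R inner (u q) (v q) = inner (u q) (v q)"
      by (cases "inner (u q) (v q) = 0") simp_all
    then show ?thesis using fun_cong[OF eq, of q] by (simp only: step_fun_def)
  qed
  then have "L2_inner m u v = (\<integral>q. (\<Sum>K\<in>cells m. indicat_real (interior (cell m K)) q *\<^sub>R ?c K) \<partial>lebesgue)"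
    unfolding L2_inner_def set_lebesgue_integral_def by simp
  also have "\<dots> = (\<Sum>K\<in>cells m. \<integral>q. indicat_real (interior (cell m K)) q *\<^sub>R ?c K \<partial>lebesgue)"
    using interior_cell_lmeasurable
    by (intro Bochner_Integration.integral_sum)
       (auto simp: fmeasurable_def intro!: integrable_mult_left integrable_real_indicator)
  also have "\<dots> = hx m * hy m * (\<Sum>K\<in>cells m. ?c K)"
    using measure_interior_cell[OF m] by (simp add: sum_distrib_left)
  finally show ?thesis .
qed

section \<open>Traces and derivatives of piecewise constant functions\<close>

text \<open>
  The limit exists and is unique because every point of a closed side, the corners included, is a limit
  point of the open cell, on which the function is constant.
\<close>

lemma trace_in_pw_const:
  assumes m: "valid_mesh m" and u: "pw_const m u" and K: "K \<in> cells m" and t: "t \<in> side_range m K s"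
  shows "trace_in m u K s t = u (center m K)"
proof -
  let ?a = "side_point m K s t" and ?I = "interior (cell m K)"
  have "?a \<in> closure ?I" "?a \<notin> ?I"
    unfolding closure_interior_cell[OF m] unfolding interior_cell using t m
    by (cases K; cases s; auto simp: cell_def x_edge_Suc y_edge_Suc valid_mesh_def)+
  then have "?a islimpt ?I" by (simp add: closure_def)
  then have "at ?a within ?I \<noteq> bot" by (simp add: trivial_limit_within)
  moreover have "(u \<longlongrightarrow> u (center m K)) (at ?a within ?I)"
    using pw_constD[OF u K] by (intro tendsto_eventually) (auto simp: eventually_at_filter)
  ultimately show ?thesis unfolding trace_in_def by (rule tendsto_Lim)
qed

lemma deriv_locally_constant:
  fixes f :: "real \<Rightarrow> real"
  assumes "a < x" "x < b" "\<And>y. a < y \<Longrightarrow> y < b \<Longrightarrow> f y = c"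
  shows "deriv f x = 0"
proof -
  have "\<forall>\<^sub>F y in nhds x. y \<in> {a<..<b}" using assms by (intro eventually_nhds_in_open) auto
  then have "\<forall>\<^sub>F y in nhds x. f y = c" by eventually_elim (use assms in auto)
  then have "deriv f x = deriv (\<lambda>_. c) x" by (intro deriv_cong_ev) auto
  then show ?thesis by simp
qed

lemma divergence_pw_const:
  assumes "pw_const m v" "K \<in> cells m" "q \<in> interior (cell m K)"
  shows "divergence v q = 0"
proof -
  have "deriv (\<lambda>x. fst (v (x, snd q))) (fst q) = 0"
    using assms(3) pw_constD[OF assms(1,2)]
    by (intro deriv_locally_constant[of "x_edge m (fst K)" _ "x_edge m (Suc (fst K))"])
       (auto simp: interior_cell)
  moreover have "deriv (\<lambda>y. snd (v (fst q, y))) (snd q) = 0"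
    using assms(3) pw_constD[OF assms(1,2)]
    by (intro deriv_locally_constant[of "y_edge m (snd K)" _ "y_edge m (Suc (snd K))"])
       (auto simp: interior_cell)
  ultimately show ?thesis by (simp add: divergence_def)
qed

lemma gradient_pw_const:
  assumes "pw_const m \<mu>" "K \<in> cells m" "q \<in> interior (cell m K)"
  shows "gradient \<mu> q = 0"
proof -
  have "deriv (\<lambda>x. \<mu> (x, snd q)) (fst q) = 0"
    using assms(3) pw_constD[OF assms(1,2)]
    by (intro deriv_locally_constant[of "x_edge m (fst K)" _ "x_edge m (Suc (fst K))"])
       (auto simp: interior_cell)
  moreover have "deriv (\<lambda>y. \<mu> (fst q, y)) (snd q) = 0"
    using assms(3) pw_constD[OF assms(1,2)]
    by (intro deriv_locally_constant[of "y_edge m (snd K)" _ "y_edge m (Suc (snd K))"])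
       (auto simp: interior_cell)
  ultimately show ?thesis by (simp add: gradient_def zero_prod_def)
qed

lemma boundary_integral_const:
  assumes m: "valid_mesh m" and g: "\<And>s t. t \<in> side_range m K s \<Longrightarrow> g s t = c s"
  shows "boundary_integral m K g = hy m * (c West + c East) + hx m * (c South + c North)"
proof -
  have "(LINT t:side_range m K s|lebesgue. g s t) = (LINT t:side_range m K s|lebesgue. c s)" for s
    unfolding set_lebesgue_integral_def using g
    by (intro Bochner_Integration.integral_cong) (auto simp: indicator_def)
  then show ?thesis using m
    by (cases K) (simp add: boundary_integral_def set_lebesgue_integral_def x_edge_Suc y_edge_Suc
        valid_mesh_def algebra_simps)
qed

section \<open>The LDG Laplacian as a five-point stencil\<close>

text \<open>
  A cell is its own neighbour across a Neumann boundary. With this reflection the two kinds of boundary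
  conditions lead to the same formulas: a flux that is taken from inside, or is zero, corresponds to a
  difference of equal values.
\<close>

definition adjacent_cell :: "boundary_cond \<Rightarrow> mesh \<Rightarrow> nat \<times> nat \<Rightarrow> side \<Rightarrow> nat \<times> nat" where
  "adjacent_cell bc m K s = (case neighbour bc m K s of None \<Rightarrow> K | Some L \<Rightarrow> L)"

lemma neighbour_in_cells:
  assumes "valid_mesh m" "K \<in> cells m" "neighbour bc m K s = Some L"
  shows "L \<in> cells m"
  using assms by (cases K; cases bc; cases s) (auto simp: cells_def valid_mesh_def split: if_splits)

lemma adjacent_in_cells:
  assumes "valid_mesh m" "K \<in> cells m"
  shows "adjacent_cell bc m K s \<in> cells m"
  using assms neighbour_in_cells[OF assms] by (auto simp: adjacent_cell_def split: option.split)

text \<open>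
  The two fluxes look across an edge from different sides; this relates the two views. It holds with
  periodic conditions also when there are only one or two cells in a direction.
\<close>

lemma neighbour_opposite:
  assumes "valid_mesh m" "K \<in> cells m" "neighbour bc m K s = Some L"
  shows "neighbour bc m L (opposite s) = Some K"
proof -
  have mod: "((i + 1) mod n + n - 1) mod n = i" "((i + n - 1) mod n + 1) mod n = i" if "i < n" for i n :: nat
  proof -
    \<comment> \<open>Only the wrap-around at the last and at the first index needs attention.\<close>
    show "((i + 1) mod n + n - 1) mod n = i" using that by (cases "i + 1 = n") auto
    show "((i + n - 1) mod n + 1) mod n = i" using that
      by (cases "i = 0") (auto simp: mod_if)
  qed
  show ?thesis using assms mod
    by (cases K; cases bc; cases s) (auto simp: cells_def valid_mesh_def split: if_splits)
qed

lemma side_range_neighbour: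
  assumes "neighbour bc m K s = Some L"
  shows "side_range m L (opposite s) = side_range m K s"
  using assms by (cases K; cases bc; cases s) (auto split: if_splits)

lemma u_flux_pw_const:
  assumes m: "valid_mesh m" and u: "pw_const m u" and K: "K \<in> cells m" and t: "t \<in> side_range m K s"
  shows "u_flux bc m u K s t
    = u (center m (if s \<in> {East, North} then K else adjacent_cell bc m K s))"
proof (cases "neighbour bc m K s")
  case None
  then show ?thesis using trace_in_pw_const[OF m u K t] by (simp add: u_flux_def adjacent_cell_def)
next
  case (Some L)
  then show ?thesis
    using trace_in_pw_const[OF m u K t] t
      trace_in_pw_const[OF m u neighbour_in_cells[OF m K Some], of t "opposite s"]
      side_range_neighbour[OF Some]
    by (simp add: u_flux_def adjacent_cell_def)
qed

text \<open>
  The numerical fluxes \<open>u_flux\<close> come from the left and from below, hence backward differences.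
\<close>

definition difference_grad ::
  "boundary_cond \<Rightarrow> mesh \<Rightarrow> (real \<times> real \<Rightarrow> real) \<Rightarrow> nat \<times> nat \<Rightarrow> real \<times> real" where
  "difference_grad bc m u K =
     ((u (center m K) - u (center m (adjacent_cell bc m K West))) / hx m,
      (u (center m K) - u (center m (adjacent_cell bc m K South))) / hy m)"

text \<open>
  On each cell \<open>v\<close> is constant and the normals of opposite sides are opposite, so the boundary integrals
  combine to differences of numerical fluxes. In this form the functional of \<open>v\<close> is an inner product
  with \<open>difference_grad\<close>, its Riesz representative.
\<close>

lemma ldg_grad_rhs:
  assumes m: "valid_mesh m" and u: "pw_const m u" and v: "pw_const m v"
  shows "- (\<Sum>K\<in>cells m. LINT q:cell m K|lebesgue. u q * divergence v q)
      + (\<Sum>K\<in>cells m. boundary_integral m K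
           (\<lambda>s t. inner (normal_vec s) (trace_in m v K s t) * u_flux bc m u K s t))
    = hx m * hy m * (\<Sum>K\<in>cells m. inner (difference_grad bc m u K) (v (center m K)))"
proof -
  \<comment> \<open>In an open cell the divergence vanishes, and elsewhere \<open>u\<close> does.\<close>
  have "u q * divergence v q = 0" for q
    using pw_const_nonzeroE[OF u, of q] divergence_pw_const[OF v] by (metis mult_eq_0_iff)
  then have "(LINT q:cell m K|lebesgue. u q * divergence v q) = 0" for K
    by (simp only: set_lebesgue_integral_def scaleR_zero_right Bochner_Integration.integral_zero)
  moreover have "boundary_integral m K
        (\<lambda>s t. inner (normal_vec s) (trace_in m v K s t) * u_flux bc m u K s t)
      = hx m * hy m * inner (difference_grad bc m u K) (v (center m K))" if K: "K \<in> cells m" for K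
  proof -
    have "boundary_integral m K
        (\<lambda>s t. inner (normal_vec s) (trace_in m v K s t) * u_flux bc m u K s t)
      = (let c = \<lambda>s. inner (normal_vec s) (v (center m K)) *
             u (center m (if s \<in> {East, North} then K else adjacent_cell bc m K s))
         in hy m * (c West + c East) + hx m * (c South + c North))"
      unfolding Let_def
      by (rule boundary_integral_const[OF m])
         (simp only: trace_in_pw_const[OF m v K] u_flux_pw_const[OF m u K])
    also have "\<dots> = hx m * hy m * inner (difference_grad bc m u K) (v (center m K))"
      using m by (cases "v (center m K)")
        (simp add: difference_grad_def valid_mesh_def field_simps)
    finally show ?thesis .
  qed
  ultimately show ?thesis by (simp add: sum_distrib_left)
qed

text \<open>
  Existence is the computation of the right hand side. For uniqueness, two candidates are compared by
  testing with their difference on a single cell.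
\<close>

lemma ldg_grad_pw_const:
  assumes m: "valid_mesh m" and u: "pw_const m u"
  shows "ldg_grad bc m u = step_fun m (difference_grad bc m u)" (is "_ = ?p")
  unfolding ldg_grad_def
proof (rule the_equality)
  have hxy: "hx m * hy m \<noteq> 0" using m by (simp add: valid_mesh_def)
  have p: "pw_const m ?p" by (rule pw_const_step_fun[OF m])
  show "?p \<in> Wh_vec m \<and> (\<forall>v\<in>Wh_vec m. L2_inner m ?p v =
        - (\<Sum>K\<in>cells m. LINT q:cell m K|lebesgue. u q * divergence v q)
        + (\<Sum>K\<in>cells m. boundary_integral m K
             (\<lambda>s t. inner (normal_vec s) (trace_in m v K s t) * u_flux bc m u K s t)))"
    using p by (simp add: Wh_vec_iff_pw_const[OF m] ldg_grad_rhs[OF m u, simplified]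
        L2_inner_pw_const[OF m] step_fun_center[OF m])
  fix p assume *: "p \<in> Wh_vec m \<and> (\<forall>v\<in>Wh_vec m. L2_inner m p v =
        - (\<Sum>K\<in>cells m. LINT q:cell m K|lebesgue. u q * divergence v q)
        + (\<Sum>K\<in>cells m. boundary_integral m K
             (\<lambda>s t. inner (normal_vec s) (trace_in m v K s t) * u_flux bc m u K s t)))"
  then have p': "pw_const m p" by (simp add: Wh_vec_iff_pw_const[OF m])
  show "p = ?p"
  proof (rule pw_const_eqI[OF p' p])
    fix K assume K: "K \<in> cells m"
    let ?d = "p (center m K) - difference_grad bc m u K"
    let ?v = "step_fun m (\<lambda>L. if L = K then ?d else 0)"
    have v: "pw_const m ?v" by (rule pw_const_step_fun[OF m])
    with * have "(\<Sum>L\<in>cells m. inner (p (center m L)) (?v (center m L)))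
        = (\<Sum>L\<in>cells m. inner (difference_grad bc m u L) (?v (center m L)))"
      using hxy by (simp add: Wh_vec_iff_pw_const[OF m] ldg_grad_rhs[OF m u, simplified]
          L2_inner_pw_const[OF m p'])
    then have "inner (p (center m K)) ?d = inner (difference_grad bc m u K) ?d"
      using K by (simp add: step_fun_center[OF m] if_distrib[of "inner _"] cong: if_cong)
    then have "inner ?d ?d = 0" by (simp add: inner_diff_left)
    then show "p (center m K) = ?p (center m K)" using K by (simp add: step_fun_center[OF m])
  qed
qed

text \<open>
  The alternating choice makes the flux symmetric: on the east side the difference is the backward
  difference of the cell to the right, on the west side that of the cell itself. In both cases it is the
  value in the neighbour minus the value in the cell, in the direction of the outward normal.
\<close>

lemma normal_p_flux_ldg_grad:
  assumes m: "valid_mesh m" and u: "pw_const m u" and K: "K \<in> cells m" and t: "t \<in> side_range m K s"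
  shows "normal_p_flux bc m (ldg_grad bc m u) K s t
    = (u (center m (adjacent_cell bc m K s)) - u (center m K)) / (if s \<in> {West, East} then hx m else hy m)"
proof (cases "neighbour bc m K s")
  case None
  then show ?thesis by (simp add: normal_p_flux_def adjacent_cell_def)
next
  case (Some L)
  have L: "L \<in> cells m" by (rule neighbour_in_cells[OF m K Some])
  have p: "pw_const m (ldg_grad bc m u)"
    unfolding ldg_grad_pw_const[OF m u] by (rule pw_const_step_fun[OF m])
  have "normal_p_flux bc m (ldg_grad bc m u) K s t
      = inner (normal_vec s) (difference_grad bc m u (if s \<in> {East, North} then L else K))"
    using trace_in_pw_const[OF m p K t] trace_in_pw_const[OF m p L, of t "opposite s"]
      side_range_neighbour[OF Some] t
    by (simp add: normal_p_flux_def Some ldg_grad_pw_const[OF m u] step_fun_center[OF m] K L)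
  moreover have "adjacent_cell bc m K s = L" "adjacent_cell bc m L (opposite s) = K"
    using Some neighbour_opposite[OF m K Some] by (simp_all add: adjacent_cell_def)
  ultimately show ?thesis
    by (cases s) (auto simp: difference_grad_def diff_divide_distrib)
qed

text \<open>
  The length of the side divided by the distance of the adjacent cell centers.
\<close>

fun stencil_weight :: "mesh \<Rightarrow> side \<Rightarrow> real" where
  "stencil_weight m West = hy m / hx m"
| "stencil_weight m East = hy m / hx m"
| "stencil_weight m South = hx m / hy m"
| "stencil_weight m North = hx m / hy m"

text \<open>
  For each cell the second LDG equation sums the outward normal fluxes over the four sides, weighted by
  their lengths.
\<close>

lemma ldg_laplacian_pw_const:
  assumes m: "valid_mesh m" and u: "pw_const m u" and \<mu>: "pw_const m \<mu>"
  shows "ldg_laplacian bc m u \<mu> = (\<Sum>K\<in>cells m. \<mu> (center m K) *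
    (\<Sum>s\<in>{West, East, South, North}. stencil_weight m s *
        (u (center m (adjacent_cell bc m K s)) - u (center m K))))"
proof -
  have p: "pw_const m (ldg_grad bc m u)"
    unfolding ldg_grad_pw_const[OF m u] by (rule pw_const_step_fun[OF m])
  have "inner (ldg_grad bc m u q) (gradient \<mu> q) = 0" for q
    using pw_const_nonzeroE[OF p, of q] gradient_pw_const[OF \<mu>]
    by (metis inner_zero_left inner_zero_right)
  then have "(LINT q:cell m K|lebesgue. inner (ldg_grad bc m u q) (gradient \<mu> q)) = 0" for K by simp
  moreover have "boundary_integral m K
          (\<lambda>s t. normal_p_flux bc m (ldg_grad bc m u) K s t * trace_in m \<mu> K s t)
      = \<mu> (center m K) * (\<Sum>s\<in>{West, East, South, North}. stencil_weight m s *
        (u (center m (adjacent_cell bc m K s)) - u (center m K)))" if K: "K \<in> cells m" for K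
  proof -
    have "boundary_integral m K
          (\<lambda>s t. normal_p_flux bc m (ldg_grad bc m u) K s t * trace_in m \<mu> K s t)
      = (let c = \<lambda>s. (u (center m (adjacent_cell bc m K s)) - u (center m K)) /
             (if s \<in> {West, East} then hx m else hy m) * \<mu> (center m K)
         in hy m * (c West + c East) + hx m * (c South + c North))"
      unfolding Let_def
      by (rule boundary_integral_const[OF m])
         (simp only: trace_in_pw_const[OF m \<mu> K] normal_p_flux_ldg_grad[OF m u K])
    also have "\<dots> = \<mu> (center m K) * (\<Sum>s\<in>{West, East, South, North}. stencil_weight m s *
        (u (center m (adjacent_cell bc m K s)) - u (center m K)))"
      using m by (simp add: valid_mesh_def field_simps)
    finally show ?thesis .
  qed
  ultimately show ?thesis by (simp add: ldg_laplacian_def)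
qed

section \<open>The matrices of the scheme\<close>

lemma cell_index_in_cells: "k < ncells m \<Longrightarrow> cell_index m k \<in> cells m"
  by (cases "Nx m = 0") (auto simp: cells_def cell_index_def ncells_def less_mult_imp_div_less mult.commute)

lemma cell_index_inj: "cell_index m k = cell_index m l \<Longrightarrow> k = l"
  unfolding cell_index_def by (metis div_mult_mod_eq prod.inject)

lemma cell_index_surj:
  assumes "K \<in> cells m"
  obtains k where "k < ncells m" "cell_index m k = K"
proof -
  obtain i j where K: "K = (i, j)" "i < Nx m" "j < Ny m" using assms by (auto simp: cells_def)
  have "i + j * Nx m < Nx m + j * Nx m" using K by simp
  also have "\<dots> = Suc j * Nx m" by simp
  also have "\<dots> \<le> Ny m * Nx m" using K by (intro mult_right_mono) auto
  finally have "i + j * Nx m < ncells m" by (simp add: ncells_def mult.commute)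
  moreover have "cell_index m (i + j * Nx m) = K" using K by (simp add: cell_index_def)
  ultimately show thesis by (rule that)
qed

lemma basis_fun_eq_step_fun:
  assumes "k < ncells m"
  shows "basis_fun m k = step_fun m (\<lambda>K. of_bool (K = cell_index m k))"
  using cell_index_in_cells[OF assms]
  by (auto simp: basis_fun_def step_fun_def fun_eq_iff of_bool_def if_distrib cong: if_cong)

lemma pw_const_basis_fun:
  assumes "valid_mesh m" "k < ncells m"
  shows "pw_const m (basis_fun m k)"
  using assms by (simp add: basis_fun_eq_step_fun pw_const_step_fun)

lemma basis_fun_center:
  assumes "valid_mesh m" "k < ncells m" "K \<in> cells m"
  shows "basis_fun m k (center m K) = of_bool (K = cell_index m k)"
  using assms by (simp add: basis_fun_eq_step_fun step_fun_center)

lemma sum_basis_fun_center: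
  assumes "valid_mesh m" "K \<in> cells m"
  shows "(\<Sum>l<ncells m. basis_fun m l (center m K)) = 1"
proof -
  obtain k where k: "k < ncells m" "cell_index m k = K" by (rule cell_index_surj[OF assms(2)])
  have "(\<Sum>l<ncells m. basis_fun m l (center m K)) = (\<Sum>l<ncells m. if l = k then 1 else 0)"
    using assms k cell_index_inj[of m]
    by (intro sum.cong) (auto simp: basis_fun_center)
  then show ?thesis using k by simp
qed

lemma basis_fun_mult:
  assumes "valid_mesh m" "k \<noteq> l"
  shows "basis_fun m k p * basis_fun m l p = 0"
  using interior_cells_disjoint[OF assms(1), of p "cell_index m k" "cell_index m l"]
    cell_index_inj[of m k l] assms(2)
  by (auto simp: basis_fun_def indicator_def)

lemma mass_mat_entry:
  assumes m: "valid_mesh m" and k: "k < ncells m" and l: "l < ncells m"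
  shows "mass_mat m $$ (k, l) = (if k = l then hx m * hy m else 0)"
proof -
  have "mass_mat m $$ (k, l) = hx m * hy m *
      (\<Sum>K\<in>cells m. of_bool (K = cell_index m l) * of_bool (K = cell_index m k))"
    using assms by (simp add: mass_mat_def form_mat_def L2_inner_pw_const pw_const_basis_fun basis_fun_center)
  also have "(\<Sum>K\<in>cells m. of_bool (K = cell_index m l) * of_bool (K = cell_index m k))
      = (\<Sum>K\<in>cells m. if K = cell_index m k then of_bool (cell_index m k = cell_index m l) else (0::real))"
    by (intro sum.cong) auto
  finally show ?thesis using cell_index_in_cells[OF k] cell_index_inj[of m k l] by auto
qed

lemma z_mat_nonneg:
  assumes "\<forall>p\<in>Omega m. 0 < z p" "k < ncells m" "l < ncells m"
  shows "0 \<le> z_mat m z $$ (k, l)"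
proof -
  have "0 \<le> indicat_real (Omega m) p *\<^sub>R inner (z p ^ 3 * basis_fun m l p) (basis_fun m k p)" for p
    using assms(1) by (auto simp: basis_fun_def indicator_def intro: less_imp_le)
  then show ?thesis using assms(2,3)
    by (simp add: z_mat_def form_mat_def L2_inner_def set_lebesgue_integral_def integral_nonneg)
qed

lemma z_mat_off_diagonal:
  assumes "valid_mesh m" "k < ncells m" "l < ncells m" "k \<noteq> l"
  shows "z_mat m z $$ (k, l) = 0"
proof -
  have "inner (z p ^ 3 * basis_fun m l p) (basis_fun m k p) = 0" for p
    using basis_fun_mult[OF assms(1), of l k p] assms(4) by auto
  then show ?thesis using assms(2,3)
    by (simp add: z_mat_def form_mat_def L2_inner_def set_lebesgue_integral_def del: inner_real_def)
qed

lemma sigma_mat_nonneg: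
  assumes m: "valid_mesh m" and z: "\<forall>p\<in>Omega m. 0 < z p" and "k < ncells m" "l < ncells m"
  shows "0 \<le> sigma_mat m z B $$ (k, l)"
proof -
  have "0 \<le> sigma m z B (center m K)" if "K \<in> cells m" for K
  proof -
    have "center m K \<in> Omega m"
      using center_in_interior[OF m] interior_subset cell_subset_Omega[OF m that] by blast
    then have "0 < z (center m K)" using z by blast
    then show ?thesis by (simp add: sigma_def temperature_def)
  qed
  then show ?thesis using assms
    by (auto simp: sigma_mat_def form_mat_def basis_fun_def valid_mesh_def intro!: sum_nonneg mult_nonneg_nonneg)
qed

lemma sigma_mat_off_diagonal:
  assumes "valid_mesh m" "k < ncells m" "l < ncells m" "k \<noteq> l"
  shows "sigma_mat m z B $$ (k, l) = 0"
proof -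
  have "basis_fun m l p * basis_fun m k p = 0" for p
    using basis_fun_mult[OF assms(1), of l k p] assms(4) by simp
  then have "hx m * hy m * (c * basis_fun m l p * basis_fun m k p) = 0" for c p
    by (simp only: mult.assoc mult_zero_right)
  then show ?thesis using assms(2,3)
    by (simp only: sigma_mat_def form_mat_def index_mat split sum.neutral_const)
qed

lemma ldg_mat_entry:
  assumes m: "valid_mesh m" and k: "k < ncells m" and l: "l < ncells m"
  shows "ldg_mat bc m $$ (k, l) = (\<Sum>s\<in>{West, East, South, North}. stencil_weight m s *
        (basis_fun m l (center m (adjacent_cell bc m (cell_index m k) s))
         - basis_fun m l (center m (cell_index m k))))"
proof -
  have "of_bool (K = cell_index m k) * x = (if K = cell_index m k then x else 0)" for K and x :: real
    by simp
  then show ?thesis using assms cell_index_in_cells[OF k]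
    by (simp add: ldg_mat_def form_mat_def ldg_laplacian_pw_const pw_const_basis_fun
        basis_fun_center[OF m k] del: sum.insert)
qed

text \<open>
  For \<open>l \<noteq> k\<close> the basis function \<open>l\<close> is zero in cell \<open>k\<close>, so only its nonnegative values in
  the neighbours of cell \<open>k\<close> contribute.
\<close>

lemma ldg_mat_off_diagonal:
  assumes m: "valid_mesh m" and k: "k < ncells m" and l: "l < ncells m" and "k \<noteq> l"
  shows "0 \<le> ldg_mat bc m $$ (k, l)"
proof -
  have "0 \<le> stencil_weight m s" for s using m by (cases s) (auto simp: valid_mesh_def)
  moreover have "basis_fun m l (center m (cell_index m k)) = 0"
    using basis_fun_center[OF m l cell_index_in_cells[OF k]] cell_index_inj[of m k l] \<open>k \<noteq> l\<close> by auto
  moreover have "0 \<le> basis_fun m l p" for p by (simp add: basis_fun_def)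
  ultimately show ?thesis unfolding ldg_mat_entry[OF m k l]
    by (intro sum_nonneg mult_nonneg_nonneg) auto
qed

text \<open>
  The basis functions sum to one on the open cells, so a row sum is the value of the stencil on a
  constant function.
\<close>

lemma ldg_mat_row_sum:
  assumes m: "valid_mesh m" and k: "k < ncells m"
  shows "(\<Sum>l<ncells m. ldg_mat bc m $$ (k, l)) = 0"
proof -
  let ?K = "cell_index m k"
  have K: "?K \<in> cells m" by (rule cell_index_in_cells[OF k])
  have "(\<Sum>l<ncells m. ldg_mat bc m $$ (k, l)) = (\<Sum>l<ncells m. \<Sum>s\<in>{West, East, South, North}.
      stencil_weight m s * (basis_fun m l (center m (adjacent_cell bc m ?K s)) - basis_fun m l (center m ?K)))"
    using ldg_mat_entry[OF m k] by (intro sum.cong) auto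
  also have "\<dots> = (\<Sum>s\<in>{West, East, South, North}. stencil_weight m s *
      ((\<Sum>l<ncells m. basis_fun m l (center m (adjacent_cell bc m ?K s)))
        - (\<Sum>l<ncells m. basis_fun m l (center m ?K))))"
    by (subst sum.swap) (simp only: sum_distrib_left[symmetric] sum_subtractf)
  also have "\<dots> = 0"
    using sum_basis_fun_center[OF m] adjacent_in_cells[OF m K] K by simp
  finally show ?thesis .
qed

section \<open>The predictor matrix\<close>

lemma form_mats_carrier:
  "mass_mat m \<in> carrier_mat (ncells m) (ncells m)"
  "z_mat m z \<in> carrier_mat (ncells m) (ncells m)"
  "sigma_mat m z B \<in> carrier_mat (ncells m) (ncells m)"
  "ldg_mat bc m \<in> carrier_mat (ncells m) (ncells m)"
  by (simp_all add: mass_mat_def z_mat_def sigma_mat_def ldg_mat_def form_mat_def)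

lemma system_mat_index:
  fixes m U
  defines "N \<equiv> ncells m"
  defines "B \<equiv> vec_last U N"
  assumes kl: "k < 2 * N" "l < 2 * N"
  shows "system_mat bc m z dt \<alpha> \<beta> a U $$ (k, l) =
    (if k < N then
       if l < N then
         mass_mat m $$ (k, l) / dt - a * \<alpha> * ldg_mat bc m $$ (k, l) + a * sigma_mat m z B $$ (k, l)
       else - (a * sigma_mat m z B $$ (k, l - N))
     else
       if l < N then - (a * z_mat m z $$ (k - N, l))
       else mass_mat m $$ (k - N, l - N) / dt + a * z_mat m z $$ (k - N, l - N)
         - a * \<beta> * ldg_mat bc m $$ (k - N, l - N))"
proof -
  note dims = form_mats_carrier[where m = m, THEN carrier_matD(1), folded N_def]
    form_mats_carrier[where m = m, THEN carrier_matD(2), folded N_def]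
  show ?thesis
    using kl unfolding system_mat_def Let_def N_def[symmetric] B_def[symmetric]
    by (subst index_mat_four_block) (auto simp: dims)
qed

text \<open>
  Adding column \<open>l\<close> of the left half to column \<open>l\<close> of the right half cancels the reaction terms entry by
  entry; the diffusion terms vanish only after summation over \<open>l\<close>.
\<close>

lemma system_mat_row_sum:
  assumes m: "valid_mesh m" and k: "k < 2 * ncells m"
  shows "(\<Sum>l<2 * ncells m. system_mat bc m z dt \<alpha> \<beta> a U $$ (k, l)) = hx m * hy m / dt"
proof -
  let ?N = "ncells m" and ?A = "system_mat bc m z dt \<alpha> \<beta> a U"
  have split: "(\<Sum>l<p + n. f l) = (\<Sum>l<p. f l) + (\<Sum>l<n. f (p + l))" for f :: "nat \<Rightarrow> real" and p n
    by (induction n) simp_all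
  have mass: "(\<Sum>l<?N. mass_mat m $$ (i, l)) = hx m * hy m" if "i < ?N" for i
    using that by (simp add: mass_mat_entry[OF m])
  have "(\<Sum>l<2 * ?N. ?A $$ (k, l)) = (\<Sum>l<?N. ?A $$ (k, l) + ?A $$ (k, ?N + l))"
    using split[of "\<lambda>l. ?A $$ (k, l)" ?N ?N] by (simp add: mult_2 sum.distrib)
  also have "\<dots> = (if k < ?N
      then (\<Sum>l<?N. mass_mat m $$ (k, l)) / dt - a * \<alpha> * (\<Sum>l<?N. ldg_mat bc m $$ (k, l))
      else (\<Sum>l<?N. mass_mat m $$ (k - ?N, l)) / dt - a * \<beta> * (\<Sum>l<?N. ldg_mat bc m $$ (k - ?N, l)))"
    using k by (simp add: system_mat_index sum_subtractf sum_divide_distrib sum_distrib_left)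
  also have "\<dots> = hx m * hy m / dt"
    using k by (simp add: mass ldg_mat_row_sum[OF m])
  finally show ?thesis .
qed

lemma system_mat_off_diagonal:
  assumes m: "valid_mesh m" and z: "\<forall>p\<in>Omega m. 0 < z p" and pos: "0 \<le> \<alpha>" "0 \<le> \<beta>" "0 \<le> a"
    and kl: "k < 2 * ncells m" "l < 2 * ncells m" "k \<noteq> l"
  shows "system_mat bc m z dt \<alpha> \<beta> a U $$ (k, l) \<le> 0"
proof -
  let ?N = "ncells m"
  have diffusion: "0 \<le> a * c * ldg_mat bc m $$ (i, j)" if "0 \<le> c" "i < ?N" "j < ?N" "i \<noteq> j" for c i j
    using ldg_mat_off_diagonal[OF m] that pos by (intro mult_nonneg_nonneg) auto
  consider "k < ?N" "l < ?N" | "k < ?N" "\<not> l < ?N" | "\<not> k < ?N" "l < ?N" | "\<not> k < ?N" "\<not> l < ?N"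
    by blast
  then show ?thesis
  proof cases
    case 1
    then show ?thesis
      using kl pos diffusion by (simp add: system_mat_index mass_mat_entry[OF m] sigma_mat_off_diagonal[OF m])
  next
    case 2
    then show ?thesis using kl pos sigma_mat_nonneg[OF m z] by (simp add: system_mat_index)
  next
    case 3
    then show ?thesis using kl pos z_mat_nonneg[OF z] by (simp add: system_mat_index)
  next
    case 4
    then have "k - ?N \<noteq> l - ?N" "k - ?N < ?N" "l - ?N < ?N" using kl by auto
    then show ?thesis
      using kl 4 pos diffusion by (simp add: system_mat_index mass_mat_entry[OF m] z_mat_off_diagonal[OF m])
  qed
qed

theorem theorem1:
  fixes m :: mesh and bc :: boundary_cond and z :: "real \<times> real \<Rightarrow> real"
    and dt \<alpha>\<^sub>0 \<beta>\<^sub>0 a :: real and U :: "real vec"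
  assumes "valid_mesh m"
    and "\<forall>p\<in>Omega m. 0 < z p"
    and "bounded (z ` Omega m)"
    and "z \<in> borel_measurable (lebesgue_on (Omega m))"
    and "0 < dt" and "0 < \<alpha>\<^sub>0" and "0 < \<beta>\<^sub>0" and "0 \<le> a"
    and "U \<in> carrier_vec (2 * ncells m)"
    and "\<forall>k<2 * ncells m. 0 \<le> U $ k"
    and "\<forall>k<ncells m. 0 < vec_last U (ncells m) $ k"
  shows "M_matrix (system_mat bc m z dt \<alpha>\<^sub>0 \<beta>\<^sub>0 a U)"
proof (rule M_matrixI)
  show "system_mat bc m z dt \<alpha>\<^sub>0 \<beta>\<^sub>0 a U \<in> carrier_mat (2 * ncells m) (2 * ncells m)"
    unfolding system_mat_def Let_def mult_2 using form_mats_carrier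
    by (intro four_block_carrier_mat minus_carrier_mat add_carrier_mat smult_carrier_mat)
next
  fix k l assume "k < 2 * ncells m" "l < 2 * ncells m" "k \<noteq> l"
  then show "system_mat bc m z dt \<alpha>\<^sub>0 \<beta>\<^sub>0 a U $$ (k, l) \<le> 0"
    using assms by (intro system_mat_off_diagonal) auto
next
  fix k assume "k < 2 * ncells m"
  then show "0 < (\<Sum>l<2 * ncells m. system_mat bc m z dt \<alpha>\<^sub>0 \<beta>\<^sub>0 a U $$ (k, l))"
    using assms by (simp add: system_mat_row_sum valid_mesh_def)
qed

end
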